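(* Let $f:\mathbb{R}^d\to\mathbb{R}$ be convex or weakly convex, with nonempty set of minimizers $\mathcal{X}^*$ and $f^*=\min_{x\in\mathbb{R}^d} f(x)$, and suppose $f(x)\ge0$ for all $x\in\mathbb{R}^d$. Let $T\ge0$ be an integer, $c>0$, $x^0\in\mathbb{R}^d$, and let the iterates be generated by the truncated subgradient method $$x^{k+1}=\operatorname*{argmin}_{x\in\mathbb{R}^d}\ \max\left\{f(x^k)+\langle g(x^k),x-x^k\rangle,\,0\right\}+\frac{1}{2\alpha_k}\|x-x^k\|^2,$$ with $g(x^k)\in\partial f(x^k)$ and step sizes $\alpha_k=\frac{\beta_k}{\|g(x^k)\|}$, $\beta_k=\frac{c}{\sqrt{T+1}}$, for $k=0,1,\ldots,T$. Then: (a) Suppose further that $f$ is convex. Let $\tilde x^T=\frac{1}{T+1}\sum_{k=0}^Tx^k$ and let $x^*\in\mathcal{X}^*$ be fixed. Let $\mathcal{A}:=\{x\in\mathbb{R}^d:\|x-x^*\|^2\le\|x^0-x^*\|^2+c^2\}$, let $\mathcal{A}'$ be any bounded open convex set containing $\mathcal{A}$, and let $L_{\mathcal{A}'}>0$ be the Lipschitz constant of $f$ on $\mathcal{A}'$. Then $$f(\tilde x^T)-f^*\le\frac{L_{\mathcal{A}'}\left(\|x^0-x^*\|^2/c+c\right)}{2\sqrt{T+1}}.$$ (b) Suppose further that $f$ is $\rho$-weakly convex and has bounded sublevel sets, and let $0<\lambda<1/\rho$. Let $\mathcal{B}:=\{x\in\mathbb{R}^d:f_\lambda(x)\le f_\lambda(x^0)+\frac{c^2}{2\lambda}\}$,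 let $\mathcal{B}'$ be any bounded open convex set containing $\mathcal{B}$, and let $L_{\mathcal{B}'}>0$ be the Lipschitz constant of $f$ on $\mathcal{B}'$. Then $$\min_{0\le k\le T}\|\nabla f_\lambda(x^k)\|^2\le\frac{L_{\mathcal{B}'}\left(f_\lambda(x^0)-f^*+\frac{c^2}{2\lambda}\right)}{c(1-\lambda\rho)\sqrt{T+1}}.$$
   Context: $\|\cdot\|$ is the Euclidean norm. $f$ is $\rho$-weakly convex ($\rho\ge0$) if $\phi(x)=f(x)+\frac\rho2\|x\|^2$ is convex; its subdifferential is $\partial f(x)=\partial\phi(x)-\rho x$, with $\partial\phi$ the convex subdifferential (for convex $f$ this is the convex subdifferential), and $g(x^k)$ is an arbitrarily chosen element of $\partial f(x^k)$. If $g(x^k)=0$, then $x^{k+1}=x^k$ regardless of the positive value assigned to $\alpha_k$. $f$ has bounded sublevel sets if $\{x\in\mathbb{R}^d:f(x)\le s\}$ is bounded for every $s\in\mathbb{R}$. The Moreau envelope is $f_\lambda(x)=\min_{y\in\mathbb{R}^d}\{f(y)+\frac1{2\lambda}\|y-x\|^2\}$; for $\lambda<1/\rho$ (with $1/0=+\infty$) it is differentiable. $f$ is not assumed globally Lipschitz; finite-valued weakly convex functions are Lipschitz on bounded sets. *)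

theory Defs
  imports "HOL-Analysis.Analysis"
begin

definition minimizers :: "('a \<Rightarrow> real) \<Rightarrow> 'a set" where
  "minimizers f = {x. is_arg_min f (\<lambda>_. True) x}"

definition weakly_convex :: "real \<Rightarrow> ('a::real_inner \<Rightarrow> real) \<Rightarrow> bool" where
  "weakly_convex \<rho> f \<longleftrightarrow> convex_on UNIV (\<lambda>x. f x + \<rho> / 2 * (norm x)\<^sup>2)"

definition convex_subdifferential :: "('a::real_inner \<Rightarrow> real) \<Rightarrow> 'a \<Rightarrow> 'a set" where
  "convex_subdifferential f x = {v. \<forall>y. f x + v \<bullet> (y - x) \<le> f y}"

definition subdifferential :: "real \<Rightarrow> ('a::real_inner \<Rightarrow> real) \<Rightarrow> 'a \<Rightarrow> 'a set" where
  "subdifferential \<rho> f x =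
     (\<lambda>v. v - \<rho> *\<^sub>R x) ` convex_subdifferential (\<lambda>y. f y + \<rho> / 2 * (norm y)\<^sup>2) x"

definition bounded_sublevel_sets :: "('a::real_inner \<Rightarrow> real) \<Rightarrow> bool" where
  "bounded_sublevel_sets f \<longleftrightarrow> (\<forall>s. bounded {x. f x \<le> s})"

(* The infimum is attained whenever f is continuous and nonnegative, see
   moreau_envelope_attained below. *)
definition moreau_envelope :: "real \<Rightarrow> ('a::real_inner \<Rightarrow> real) \<Rightarrow> 'a \<Rightarrow> real" where
  "moreau_envelope lam f x = (INF y. f y + 1 / (2 * lam) * (norm (y - x))\<^sup>2)"

definition gradient :: "('a::real_inner \<Rightarrow> real) \<Rightarrow> 'a \<Rightarrow> 'a" where
  "gradient f x = (THE v. GDERIV f x :> v)"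

lemma gradient_eqI:
  assumes "GDERIV f x :> v"
  shows "gradient f x = v"
  unfolding gradient_def
proof (rule the_equality)
  show "GDERIV f x :> v" by fact
next
  fix w assume "GDERIV f x :> w"
  then have "(\<lambda>h. h \<bullet> w) = (\<lambda>h. h \<bullet> v)"
    using assms has_derivative_unique unfolding gderiv_def by blast
  then have "(w - v) \<bullet> w = (w - v) \<bullet> v" by metis
  then show "w = v" by (metis inner_diff_right inner_eq_zero_iff right_minus_eq)
qed

(* For convex f the modulus is irrelevant: the subdifferential is the convex one. *)
lemma subdifferential_convex:
  fixes f :: "'a::real_inner \<Rightarrow> real"
  assumes f: "convex_on UNIV f" and "0 \<le> \<rho>"
  shows "subdifferential \<rho> f x = convex_subdifferential f x"
proof (rule set_eqI)
  fix v
  have sq: "\<rho> / 2 * (norm y)\<^sup>2 = \<rho> / 2 * (norm x)\<^sup>2 + (\<rho> *\<^sub>R x) \<bullet> (y - x) + \<rho> / 2 * (norm (y - x))\<^sup>2"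
    for y by (simp add: power2_norm_eq_inner algebra_simps inner_commute)
  have "v \<in> subdifferential \<rho> f x \<longleftrightarrow>
      v + \<rho> *\<^sub>R x \<in> convex_subdifferential (\<lambda>y. f y + \<rho> / 2 * (norm y)\<^sup>2) x"
    unfolding subdifferential_def by (metis (no_types, lifting) add_diff_cancel diff_add_cancel image_iff)
  also have "\<dots> \<longleftrightarrow> (\<forall>y. f x + v \<bullet> (y - x) \<le> f y + \<rho> / 2 * (norm (y - x))\<^sup>2)"
    unfolding convex_subdifferential_def mem_Collect_eq
    by (intro all_cong1, subst sq) (simp add: inner_add_left)
  also have "\<dots> \<longleftrightarrow> v \<in> convex_subdifferential f x"
  proof
    assume H: "\<forall>y. f x + v \<bullet> (y - x) \<le> f y + \<rho> / 2 * (norm (y - x))\<^sup>2"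
    have "f x + v \<bullet> (y - x) \<le> f y" for y
    proof -
      let ?q = "\<rho> / 2 * (norm (y - x))\<^sup>2"
      have "v \<bullet> (y - x) - (f y - f x) \<le> t * ?q" if t: "t \<in> {0<..<1}" for t
      proof -
        have z: "(1 - t) *\<^sub>R x + t *\<^sub>R y - x = t *\<^sub>R (y - x)" by (simp add: algebra_simps)
        have "f x + v \<bullet> (t *\<^sub>R (y - x)) \<le> f ((1 - t) *\<^sub>R x + t *\<^sub>R y) + \<rho> / 2 * (norm (t *\<^sub>R (y - x)))\<^sup>2"
          using H z by metis
        also have "(norm (t *\<^sub>R (y - x)))\<^sup>2 = t\<^sup>2 * (norm (y - x))\<^sup>2"
          by (simp add: power_mult_distrib)
        also have "f ((1 - t) *\<^sub>R x + t *\<^sub>R y) \<le> (1 - t) * f x + t * f y"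
          using convex_onD[OF f, of t x y] t by auto
        finally have "t * (v \<bullet> (y - x) - (f y - f x)) \<le> t * (t * ?q)"
          by (simp add: algebra_simps power2_eq_square)
        then show ?thesis using t by simp
      qed
      then have "\<forall>\<^sub>F t in at_right 0. v \<bullet> (y - x) - (f y - f x) \<le> t * ?q"
        by (intro eventually_at_rightI[of 0 1]) auto
      moreover have "((\<lambda>t. t * ?q) \<longlongrightarrow> 0 * ?q) (at_right 0)"
        by (intro tendsto_intros)
      ultimately have "v \<bullet> (y - x) - (f y - f x) \<le> 0 * ?q"
        by (intro tendsto_lowerbound[OF _ _ trivial_limit_at_right_real])
      then show ?thesis by simp
    qed
    then show "v \<in> convex_subdifferential f x" by (simp add: convex_subdifferential_def)
  next
    assume v: "v \<in> convex_subdifferential f x"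
    show "\<forall>y. f x + v \<bullet> (y - x) \<le> f y + \<rho> / 2 * (norm (y - x))\<^sup>2"
    proof
      fix y
      have "f x + v \<bullet> (y - x) \<le> f y" using v by (simp add: convex_subdifferential_def)
      moreover have "0 \<le> \<rho> / 2 * (norm (y - x))\<^sup>2" using \<open>0 \<le> \<rho>\<close> by simp
      ultimately show "f x + v \<bullet> (y - x) \<le> f y + \<rho> / 2 * (norm (y - x))\<^sup>2" by linarith
    qed
  qed
  finally show "v \<in> subdifferential \<rho> f x \<longleftrightarrow> v \<in> convex_subdifferential f x" .
qed

lemma moreau_envelope_attained:
  fixes f :: "'a::euclidean_space \<Rightarrow> real"
  assumes cont: "continuous_on UNIV f" and nonneg: "\<And>y. 0 \<le> f y" and "0 < lam"
  shows "\<exists>y. moreau_envelope lam f x = f y + 1 / (2 * lam) * (norm (y - x))\<^sup>2"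
proof -
  define h where "h = (\<lambda>y. f y + 1 / (2 * lam) * (norm (y - x))\<^sup>2)"
  define r where "r = sqrt (2 * lam * f x)"
  have r: "0 \<le> r" "r\<^sup>2 = 2 * lam * f x"
    using nonneg[of x] \<open>0 < lam\<close> by (simp_all add: r_def)
  have "continuous_on (cball x r) h"
    unfolding h_def by (intro continuous_intros continuous_on_subset[OF cont]) auto
  then obtain y where y: "y \<in> cball x r" "\<And>z. z \<in> cball x r \<Longrightarrow> h y \<le> h z"
    using continuous_attains_inf[of "cball x r" h] r by auto
  have "h y \<le> h z" for z
  proof (cases "z \<in> cball x r")
    case False
    then have "r\<^sup>2 \<le> (norm (z - x))\<^sup>2"
      using r by (intro power_mono) (auto simp: dist_norm norm_minus_commute)
    then have "f x \<le> 1 / (2 * lam) * (norm (z - x))\<^sup>2"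
      using r \<open>0 < lam\<close> by (simp add: field_simps)
    then have "h x \<le> h z" using nonneg[of z] by (simp add: h_def)
    with y(2)[of x] r show ?thesis by simp
  qed (use y in auto)
  then have "(INF z. h z) = h y"
    by (intro cInf_eq_minimum) auto
  then show ?thesis unfolding moreau_envelope_def h_def by blast
qed

end

theory Submission
  imports Defs
begin

text \<open>
  Both parts rest on one three-point inequality: the truncated model plus the proximal term is
  strongly convex with modulus \<open>1 / \<alpha>\<close>, so its minimizer \<open>q\<close> satisfies
  \<open>\<parallel>y - q\<parallel>\<^sup>2 \<le> \<parallel>y - x\<parallel>\<^sup>2 + 2 \<alpha> (m y - f x) + \<alpha>\<^sup>2 \<parallel>g\<parallel>\<^sup>2\<close> for every \<open>y\<close>, where \<open>m\<close> is the
  truncated model. In the convex case take \<open>y = x\<^sup>*\<close>, where \<open>m y \<le> f\<^sup>*\<close> because \<open>f \<ge> 0\<close>. In the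
  weakly convex case take for \<open>y\<close> the proximal point of \<open>x\<close>, which turns the inequality into a
  descent estimate for the Moreau envelope. The iterates stay in the set on which \<open>f\<close> is
  \<open>L\<close>-Lipschitz, so \<open>\<parallel>g\<parallel> \<le> L\<close> there, and summing over the steps gives the rates.
\<close>

section \<open>Strong convexity and growth away from a minimizer\<close>

lemma norm_convex_comb_sq:
  fixes p y :: "'a::real_inner"
  shows "(norm ((1 - t) *\<^sub>R p + t *\<^sub>R y))\<^sup>2 =
    (1 - t) * (norm p)\<^sup>2 + t * (norm y)\<^sup>2 - t * (1 - t) * (norm (y - p))\<^sup>2"
  by (simp add: power2_norm_eq_inner algebra_simps inner_commute)

text \<open>This is the limit t -> 0+, taken after an inequality along a segment has been divided by
  its length parameter.\<close>

lemma le_of_scaled_remainder: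
  fixes a b r :: real
  assumes "\<And>t. 0 < t \<Longrightarrow> t < 1 \<Longrightarrow> a \<le> b + t * r"
  shows "a \<le> b"
proof -
  have "\<forall>\<^sub>F t in at_right 0. a \<le> b + t * r"
    using assms by (intro eventually_at_rightI[of 0 1]) auto
  moreover have "((\<lambda>t. b + t * r) \<longlongrightarrow> b + 0 * r) (at_right 0)"
    by (intro tendsto_intros)
  ultimately have "a \<le> b + 0 * r"
    by (intro tendsto_lowerbound[OF _ _ trivial_limit_at_right_real])
  then show ?thesis by simp
qed

lemma convex_on_inner_add_const: "convex_on UNIV (\<lambda>y. w \<bullet> y + (b::real))"
  by (rule convex_onI) (auto simp: inner_simps algebra_simps)

lemma convex_on_max:
  assumes "convex_on S f" and "convex_on S g"
  shows "convex_on S (\<lambda>y. max (f y) (g y))"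
proof (rule convex_onI)
  fix t x y assume *: "0 < t" "t < (1::real)" "x \<in> S" "y \<in> S"
  let ?m = "\<lambda>y. max (f y) (g y)" and ?z = "(1 - t) *\<^sub>R x + t *\<^sub>R y"
  have "(1 - t) * f x + t * f y \<le> (1 - t) * ?m x + t * ?m y"
    and "(1 - t) * g x + t * g y \<le> (1 - t) * ?m x + t * ?m y"
    using * by (intro add_mono mult_left_mono; simp)+
  moreover have "f ?z \<le> (1 - t) * f x + t * f y" "g ?z \<le> (1 - t) * g x + t * g y"
    using assms * by (auto intro: convex_onD)
  ultimately show "?m ?z \<le> (1 - t) * ?m x + t * ?m y" by linarith
qed (use assms convex_on_imp_convex in blast)

text \<open>A negative modulus in \<^const>\<open>weakly_convex\<close> expresses strong convexity.\<close>

lemma weakly_convex_add_dist_sq: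
  assumes "weakly_convex \<rho> f"
  shows "weakly_convex (\<rho> - \<kappa>) (\<lambda>y. f y + \<kappa> / 2 * (norm (y - x))\<^sup>2)"
proof -
  have "convex_on UNIV (\<lambda>y. (f y + \<rho> / 2 * (norm y)\<^sup>2) + ((- \<kappa> *\<^sub>R x) \<bullet> y + \<kappa> / 2 * (norm x)\<^sup>2))"
    by (rule convex_on_add[OF assms[unfolded weakly_convex_def] convex_on_inner_add_const])
  moreover have "(\<lambda>y. (f y + \<rho> / 2 * (norm y)\<^sup>2) + ((- \<kappa> *\<^sub>R x) \<bullet> y + \<kappa> / 2 * (norm x)\<^sup>2)) =
     (\<lambda>y. (f y + \<kappa> / 2 * (norm (y - x))\<^sup>2) + (\<rho> - \<kappa>) / 2 * (norm y)\<^sup>2)"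
    by (rule ext) (simp add: power2_norm_eq_inner algebra_simps inner_commute diff_divide_distrib)
  ultimately show ?thesis by (simp add: weakly_convex_def)
qed

text \<open>Minimality of \<open>p\<close> is tested at points of the segment from \<open>p\<close>
  to \<open>y\<close>. Strong convexity leaves a gain of t (1 - t) \<mu> / 2 times the squared
  distance; after division by t, letting t tend to 0 yields the full factor \<mu> / 2.\<close>

lemma strongly_convex_minimum_growth:
  assumes "weakly_convex (- \<mu>) \<psi>" and min: "\<And>z. \<psi> p \<le> \<psi> z"
  shows "\<psi> p + \<mu> / 2 * (norm (y - p))\<^sup>2 \<le> \<psi> y"
proof (rule le_of_scaled_remainder)
  fix t :: real assume t: "0 < t" "t < 1"
  let ?z = "(1 - t) *\<^sub>R p + t *\<^sub>R y"
  have "\<psi> ?z + (- \<mu>) / 2 * (norm ?z)\<^sup>2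
      \<le> (1 - t) * (\<psi> p + (- \<mu>) / 2 * (norm p)\<^sup>2) + t * (\<psi> y + (- \<mu>) / 2 * (norm y)\<^sup>2)"
    using convex_onD[OF assms(1)[unfolded weakly_convex_def], of t p y] t by auto
  then have "\<psi> ?z \<le> (1 - t) * \<psi> p + t * \<psi> y - t * (1 - t) * (\<mu> / 2 * (norm (y - p))\<^sup>2)"
    unfolding norm_convex_comb_sq by (simp add: algebra_simps diff_divide_distrib)
  with min[of ?z] have "t * (\<psi> p + (1 - t) * (\<mu> / 2 * (norm (y - p))\<^sup>2)) \<le> t * \<psi> y"
    by (simp add: algebra_simps)
  then have "\<psi> p + (1 - t) * (\<mu> / 2 * (norm (y - p))\<^sup>2) \<le> \<psi> y"
    using t by simp
  then show "\<psi> p + \<mu> / 2 * (norm (y - p))\<^sup>2 \<le> \<psi> y + t * (\<mu> / 2 * (norm (y - p))\<^sup>2)"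
    unfolding left_diff_distrib by linarith
qed

section \<open>Weakly convex subgradients\<close>

lemma subdifferentialD:
  assumes "v \<in> subdifferential \<rho> f x"
  shows "f x + v \<bullet> (y - x) \<le> f y + \<rho> / 2 * (norm (y - x))\<^sup>2"
proof -
  have "f x + \<rho> / 2 * (norm x)\<^sup>2 + (v + \<rho> *\<^sub>R x) \<bullet> (y - x) \<le> f y + \<rho> / 2 * (norm y)\<^sup>2"
    using assms by (auto simp: subdifferential_def convex_subdifferential_def)
  then show ?thesis
    by (simp add: power2_norm_eq_inner algebra_simps inner_commute)
qed

text \<open>Along \<open>v\<close> the subgradient inequality forces \<open>f\<close> to rise at
  rate \<open>norm v\<close>, up to an error quadratic in the step, while the Lipschitz condition
  allows rate at most \<open>L\<close>. Openness of \<open>S\<close> leaves room for such a step,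
  and the error vanishes with its length.\<close>

lemma norm_subgradient_le_lipschitz:
  assumes v: "v \<in> subdifferential \<rho> f x" and lip: "L-lipschitz_on S f" and S: "open S" "x \<in> S"
  shows "norm v \<le> L"
proof (cases "v = 0")
  case True
  then show ?thesis using lipschitz_on_nonneg[OF lip] by simp
next
  case False
  obtain e where e: "0 < e" "ball x e \<subseteq> S"
    using S by (meson openE)
  \<comment> \<open>With this scale the test point lies at distance t e < e from \<open>x\<close>,
    hence in \<open>S\<close>.\<close>
  define s where "s = e / norm v"
  have "0 < s" using e False by (simp add: s_def)
  show ?thesis
  proof (rule le_of_scaled_remainder)
    fix t :: real assume t: "0 < t" "t < 1"
    let ?y = "x + (t * s) *\<^sub>R v"
    have ts: "0 < t * s" using t \<open>0 < s\<close> by simp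
    have "norm (?y - x) = t * e" using t e False by (simp add: s_def)
    also have "\<dots> < e" using t e by simp
    finally have "?y \<in> S" using e by (auto simp: dist_norm norm_minus_commute)
    then have "f ?y - f x \<le> L * (t * s * norm v)"
      using lipschitz_onD[OF lip, of ?y x] S ts
      by (simp add: dist_norm)
    moreover have "f x + t * s * (norm v)\<^sup>2 \<le> f ?y + \<rho> / 2 * (t * s * norm v)\<^sup>2"
      using subdifferentialD[OF v, of ?y] ts by (simp add: power2_norm_eq_inner power_mult_distrib)
    ultimately have "t * s * norm v * norm v
        \<le> t * s * norm v * (L + t * (s * \<rho> / 2 * norm v))"
      by (simp add: power2_eq_square algebra_simps)
    moreover have "0 < t * s * norm v" using ts False by simp
    ultimately show "norm v \<le> L + t * (s * \<rho> / 2 * norm v)"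
      using mult_le_cancel_left_pos by blast
  qed
qed

section \<open>One truncated step and the summation over steps\<close>

lemma truncated_step_three_point:
  assumes "0 < \<alpha>"
    and "is_arg_min (\<lambda>y. max (v + g \<bullet> (y - x)) 0 + 1 / (2 * \<alpha>) * (norm (y - x))\<^sup>2) (\<lambda>_. True) q"
  shows "(norm (y - q))\<^sup>2 \<le> (norm (y - x))\<^sup>2
    + 2 * \<alpha> * (max (v + g \<bullet> (y - x)) 0 - v) + \<alpha>\<^sup>2 * (norm g)\<^sup>2"
proof -
  define m where "m = (\<lambda>y. max (v + g \<bullet> (y - x)) 0)"
  define \<psi> where "\<psi> = (\<lambda>y. m y + 1 / \<alpha> / 2 * (norm (y - x))\<^sup>2)"
  \<comment> \<open>The truncation level 0 is written as an affine function, so the model is a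
    maximum of two affine pieces.\<close>
  have "convex_on UNIV (\<lambda>y. max (g \<bullet> y + (v - g \<bullet> x)) (0 \<bullet> y + 0))"
    by (intro convex_on_max convex_on_inner_add_const)
  then have "weakly_convex 0 m"
    by (simp add: weakly_convex_def m_def inner_diff_right algebra_simps)
  from weakly_convex_add_dist_sq[OF this, of "1 / \<alpha>" x]
  have sc: "weakly_convex (- (1 / \<alpha>)) \<psi>" by (simp add: \<psi>_def)
  have "\<psi> q \<le> \<psi> z" for z
    using assms(2) by (auto simp: is_arg_min_linorder \<psi>_def m_def mult.commute)
  from strongly_convex_minimum_growth[OF sc this, of y]
  have "2 * \<alpha> * (\<psi> q + 1 / \<alpha> / 2 * (norm (y - q))\<^sup>2) \<le> 2 * \<alpha> * \<psi> y"
    using \<open>0 < \<alpha>\<close> by simp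
  then have main: "2 * \<alpha> * m q + (norm (q - x))\<^sup>2 + (norm (y - q))\<^sup>2
      \<le> 2 * \<alpha> * m y + (norm (y - x))\<^sup>2"
    using \<open>0 < \<alpha>\<close> by (simp add: \<psi>_def distrib_left)
  \<comment> \<open>This square removes \<open>q\<close> from the estimate: once \<open>m q\<close>
    is bounded below by its affine piece, the remaining terms in \<open>q - x\<close> cost at most
    \<alpha>^2 times the squared norm of \<open>g\<close>.\<close>
  have "0 \<le> (norm (q - x + \<alpha> *\<^sub>R g))\<^sup>2" by simp
  also have "(norm (q - x + \<alpha> *\<^sub>R g))\<^sup>2
      = (norm (q - x))\<^sup>2 + 2 * \<alpha> * (g \<bullet> (q - x)) + \<alpha>\<^sup>2 * (norm g)\<^sup>2"
    unfolding power2_norm_eq_inner by (simp add: inner_simps inner_commute power2_eq_square algebra_simps)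
  finally have "0 \<le> (norm (q - x))\<^sup>2 + 2 * \<alpha> * (g \<bullet> (q - x)) + \<alpha>\<^sup>2 * (norm g)\<^sup>2" .
  moreover have "2 * \<alpha> * (v + g \<bullet> (q - x)) \<le> 2 * \<alpha> * m q"
    using \<open>0 < \<alpha>\<close> by (simp add: m_def)
  ultimately show ?thesis using main by (simp add: m_def algebra_simps)
qed

text \<open>For \<open>g = 0\<close> the model equals \<open>v\<close>, which forces \<open>D = 0\<close>; so no case split is needed later.\<close>

lemma truncated_step_decrease:
  assumes "0 < \<alpha>" and \<alpha>: "g \<noteq> 0 \<Longrightarrow> \<alpha> = \<beta> / norm g" and "0 < \<beta>"
    and "norm g \<le> L" and "0 \<le> v" and "0 \<le> D"
    and D: "max (v + g \<bullet> (y - x)) 0 + D \<le> v"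
    and q: "is_arg_min (\<lambda>y. max (v + g \<bullet> (y - x)) 0 + 1 / (2 * \<alpha>) * (norm (y - x))\<^sup>2) (\<lambda>_. True) q"
  shows "(norm (y - q))\<^sup>2 \<le> (norm (y - x))\<^sup>2 - 2 * \<beta> / L * D + \<beta>\<^sup>2"
proof (cases "g = 0")
  case True
  then have "D = 0" using D \<open>0 \<le> v\<close> \<open>0 \<le> D\<close> by simp
  moreover have "(norm (y - q))\<^sup>2 \<le> (norm (y - x))\<^sup>2"
    using truncated_step_three_point[OF \<open>0 < \<alpha>\<close> q, of y] True \<open>0 \<le> v\<close> by simp
  ultimately show ?thesis by (simp add: add_increasing2)
next
  case False
  note \<alpha> = \<alpha>[OF False]
  have "\<alpha> * (max (v + g \<bullet> (y - x)) 0 - v) \<le> \<alpha> * (- D)"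
    using D \<open>0 < \<alpha>\<close> by (intro mult_left_mono) auto
  \<comment> \<open>The bound \<open>norm g \<le> L\<close> makes the normalized step at least
    \<beta> / L; the same normalization turns the quadratic error into exactly \<beta>^2.\<close>
  moreover have "\<beta> / L * D \<le> \<alpha> * D"
    unfolding \<alpha> using False \<open>norm g \<le> L\<close> \<open>0 < \<beta>\<close> \<open>0 \<le> D\<close>
    by (intro mult_right_mono frac_le) auto
  moreover have "\<alpha>\<^sup>2 * (norm g)\<^sup>2 = \<beta>\<^sup>2"
    using False by (simp add: \<alpha> power_divide)
  ultimately show ?thesis
    using truncated_step_three_point[OF \<open>0 < \<alpha>\<close> q, of y] by simp
qed

text \<open>The decrease is only required while the sequence stays below the bound, which it never leaves.\<close>

lemma sum_decrease_le:
  fixes a D :: "nat \<Rightarrow> real"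
  assumes step: "\<And>k. k \<le> T \<Longrightarrow> a k \<le> a 0 + (real T + 1) * \<gamma> \<Longrightarrow> a (Suc k) \<le> a k - \<eta> * D k + \<gamma>"
    and "\<And>k. 0 \<le> D k" and "0 \<le> \<eta>" and "0 \<le> \<gamma>"
  shows "a (Suc T) + \<eta> * (\<Sum>k=0..T. D k) \<le> a 0 + (real T + 1) * \<gamma>"
proof -
  have "a k + \<eta> * (\<Sum>i<k. D i) \<le> a 0 + real k * \<gamma>" if "k \<le> Suc T" for k
    using that
  proof (induction k)
    case (Suc k)
    have "0 \<le> \<eta> * (\<Sum>i<k. D i)" using assms by (simp add: sum_nonneg)
    moreover have "real k * \<gamma> \<le> (real T + 1) * \<gamma>"
      using Suc.prems \<open>0 \<le> \<gamma>\<close> by (intro mult_right_mono) auto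
    ultimately have "a k \<le> a 0 + (real T + 1) * \<gamma>"
      using Suc by simp
    then show ?case using step[of k] Suc by (simp add: algebra_simps)
  qed simp
  from this[of "Suc T"] show ?thesis
    by (simp add: atLeast0AtMost lessThan_Suc_atMost add.commute)
qed

section \<open>The Moreau envelope and its gradient\<close>

lemma GDERIV_quadratic_remainder:
  assumes "\<And>z. \<bar>F z - F x - (z - x) \<bullet> v\<bar> \<le> K * (norm (z - x))\<^sup>2"
  shows "GDERIV F x :> v"
  unfolding gderiv_def has_derivative_at
proof
  show "bounded_linear (\<lambda>h. h \<bullet> v)" by (rule bounded_linear_inner_left)
  show "(\<lambda>h. norm (F (x + h) - F x - h \<bullet> v) / norm h) \<midarrow>0\<rightarrow> 0"
  proof (rule Lim_null_comparison)
    show "\<forall>\<^sub>F h in at 0. norm (norm (F (x + h) - F x - h \<bullet> v) / norm h) \<le> K * norm h"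
    proof (rule always_eventually, rule allI)
      fix h
      \<comment> \<open>At \<open>h = 0\<close> the quotient is 0 by the convention for division by
        zero, so the bound holds for every \<open>h\<close>.\<close>
      show "norm (norm (F (x + h) - F x - h \<bullet> v) / norm h) \<le> K * norm h"
        using assms[of "x + h"]
        by (cases "h = 0") (auto simp: divide_le_eq power2_eq_square mult.assoc)
    qed
    show "(\<lambda>h. K * norm (h::'a)) \<midarrow>0\<rightarrow> 0"
      by (intro tendsto_mult_right_zero tendsto_norm_zero tendsto_ident_at)
  qed
qed

lemma weakly_convex_imp_continuous:
  fixes f :: "'a::euclidean_space \<Rightarrow> real"
  assumes "weakly_convex \<rho> f"
  shows "continuous_on UNIV f"
proof -
  have "continuous_on UNIV (\<lambda>y. f y + \<rho> / 2 * (norm y)\<^sup>2)"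
    using assms by (intro convex_on_continuous) (auto simp: weakly_convex_def)
  then have "continuous_on UNIV (\<lambda>y. (f y + \<rho> / 2 * (norm y)\<^sup>2) - \<rho> / 2 * (norm y)\<^sup>2)"
    by (rule continuous_on_diff) (intro continuous_intros)
  then show ?thesis by (simp only: add_diff_cancel_right')
qed

lemma moreau_envelope_le:
  assumes "\<And>y. 0 \<le> f y" and "0 < lam"
  shows "moreau_envelope lam f x \<le> f y + 1 / (2 * lam) * (norm (y - x))\<^sup>2"
  unfolding moreau_envelope_def
  using assms by (intro cINF_lower bdd_belowI2[where m = 0]) auto

text \<open>The proximal objective is strongly convex with modulus 1 / lam - \<rho>, which gives the
  growth around \<open>p\<close>. For the gradient, the envelope at \<open>z\<close> is squeezed
  between quadratics: \<open>p\<close> is a competitor at \<open>z\<close> (upper bound), and the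
  growth at \<open>x\<close> is applied to a minimizer \<open>q\<close> for \<open>z\<close> (lower
  bound).\<close>

lemma moreau_envelope_proximal_point:
  fixes f :: "'a::euclidean_space \<Rightarrow> real"
  assumes wc: "weakly_convex \<rho> f" and nonneg: "\<And>y. 0 \<le> f y"
    and lam: "0 < lam" "\<rho> < 1 / lam"
  obtains p where "moreau_envelope lam f x = f p + 1 / (2 * lam) * (norm (p - x))\<^sup>2"
    and "\<And>y. moreau_envelope lam f x + (1 / lam - \<rho>) / 2 * (norm (y - p))\<^sup>2
           \<le> f y + 1 / (2 * lam) * (norm (y - x))\<^sup>2"
    and "gradient (moreau_envelope lam f) x = (1 / lam) *\<^sub>R (x - p)"
proof -
  let ?e = "moreau_envelope lam f"
  define \<mu> where "\<mu> = 1 / lam - \<rho>"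
  have "0 < \<mu>" using lam by (simp add: \<mu>_def)
  obtain p where p: "?e x = f p + 1 / (2 * lam) * (norm (p - x))\<^sup>2"
    using moreau_envelope_attained[OF weakly_convex_imp_continuous[OF wc] nonneg lam(1)] by blast
  have "weakly_convex (- \<mu>) (\<lambda>y. f y + 1 / (2 * lam) * (norm (y - x))\<^sup>2)"
    using weakly_convex_add_dist_sq[OF wc, of "1 / lam" x] by (simp add: \<mu>_def mult.commute)
  note sc = strongly_convex_minimum_growth[OF this, of p]
  have growth: "?e x + \<mu> / 2 * (norm (y - p))\<^sup>2 \<le> f y + 1 / (2 * lam) * (norm (y - x))\<^sup>2" for y
    unfolding p
    by (rule sc) (use moreau_envelope_le[where f = f, OF nonneg lam(1), of x] in \<open>simp only: p\<close>)
  define v where "v = (1 / lam) *\<^sub>R (x - p)"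
  \<comment> \<open>The first summand serves the upper bound; the second is the cost of completing
    the square in the lower bound.\<close>
  define K where "K = 1 / (2 * lam) + 1 / (2 * lam\<^sup>2 * \<mu>)"
  \<comment> \<open>The cross term is split at \<open>p\<close>: one part is the linear term with
    the candidate gradient \<open>v\<close>, and the other vanishes for
    \<open>y = p\<close>.\<close>
  have shift: "1 / (2 * lam) * (norm (y - z))\<^sup>2 = 1 / (2 * lam) * (norm (y - x))\<^sup>2
      + (z - x) \<bullet> v + 1 / (2 * lam) * (norm (z - x))\<^sup>2 - (1 / lam) * ((y - p) \<bullet> (z - x))" for y z
    unfolding v_def power2_norm_eq_inner using lam
    by (simp add: inner_simps inner_commute field_simps)
  have "\<bar>?e z - ?e x - (z - x) \<bullet> v\<bar> \<le> K * (norm (z - x))\<^sup>2" for z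
  proof -
    have "?e z \<le> f p + 1 / (2 * lam) * (norm (p - z))\<^sup>2"
      by (rule moreau_envelope_le[where f = f, OF nonneg lam(1)])
    then have "?e z - ?e x - (z - x) \<bullet> v \<le> 1 / (2 * lam) * (norm (z - x))\<^sup>2"
      unfolding shift[of p z] p by simp
    also have "\<dots> \<le> K * (norm (z - x))\<^sup>2"
      unfolding K_def using \<open>0 < \<mu>\<close> by (intro mult_right_mono) auto
    finally have upper: "?e z - ?e x - (z - x) \<bullet> v \<le> K * (norm (z - x))\<^sup>2" .
    obtain q where q: "?e z = f q + 1 / (2 * lam) * (norm (q - z))\<^sup>2"
      using moreau_envelope_attained[OF weakly_convex_imp_continuous[OF wc] nonneg lam(1)] by blast
    \<comment> \<open>The shift is the value of \<open>q - p\<close> at which the growth term minus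
      the cross term of \<open>shift\<close> is smallest.\<close>
    have "0 \<le> \<mu> / 2 * (norm ((q - p) - (1 / (lam * \<mu>)) *\<^sub>R (z - x)))\<^sup>2"
      using \<open>0 < \<mu>\<close> by simp
    also have "\<dots> = \<mu> / 2 * (norm (q - p))\<^sup>2 - (1 / lam) * ((q - p) \<bullet> (z - x))
        + 1 / (2 * lam\<^sup>2 * \<mu>) * (norm (z - x))\<^sup>2"
    proof -
      have *: "(norm (a - s *\<^sub>R b))\<^sup>2 = (norm a)\<^sup>2 - 2 * s * (a \<bullet> b) + s\<^sup>2 * (norm b)\<^sup>2" for a b :: 'a and s
        unfolding power2_norm_eq_inner
        by (simp add: inner_simps inner_commute power2_eq_square algebra_simps)
      show ?thesis
        unfolding * using lam \<open>0 < \<mu>\<close> by (simp add: field_simps power2_eq_square)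
    qed
    finally have "?e z - ?e x - (z - x) \<bullet> v
        \<ge> 1 / (2 * lam) * (norm (z - x))\<^sup>2 - 1 / (2 * lam\<^sup>2 * \<mu>) * (norm (z - x))\<^sup>2"
      using growth[of q] shift[of q z] q by linarith
    moreover have "0 \<le> 1 / (2 * lam) * (norm (z - x))\<^sup>2" using lam by simp
    ultimately have "?e z - ?e x - (z - x) \<bullet> v \<ge> - (K * (norm (z - x))\<^sup>2)"
      unfolding K_def distrib_right by linarith
    with upper show ?thesis by linarith
  qed
  then have "gradient ?e x = v"
    by (intro gradient_eqI GDERIV_quadratic_remainder)
  then show thesis
    using that[of p] p growth unfolding v_def \<mu>_def by blast
qed

section \<open>The two convergence rates\<close>

theorem corollary3:
  fixes f :: "real ^ 'd \<Rightarrow> real"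
    and x g :: "nat \<Rightarrow> real ^ 'd"
    and \<alpha> \<beta> :: "nat \<Rightarrow> real"
    and \<rho> c fstar :: real
    and T :: nat
  assumes "0 \<le> \<rho>"
    and "weakly_convex \<rho> f"
    and "minimizers f \<noteq> {}"
    and "fstar = (INF y. f y)"
    and "\<And>y. 0 \<le> f y"
    and "0 < c"
    and "\<And>k. k \<le> T \<Longrightarrow> g k \<in> subdifferential \<rho> f (x k)"
    and "\<And>k. k \<le> T \<Longrightarrow> \<beta> k = c / sqrt (real T + 1)"
    and "\<And>k. k \<le> T \<Longrightarrow> 0 < \<alpha> k"
    and "\<And>k. k \<le> T \<Longrightarrow> g k \<noteq> 0 \<Longrightarrow> \<alpha> k = \<beta> k / norm (g k)"
    and "\<And>k. k \<le> T \<Longrightarrow>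
           is_arg_min
             (\<lambda>y. max (f (x k) + g k \<bullet> (y - x k)) 0 + 1 / (2 * \<alpha> k) * (norm (y - x k))\<^sup>2)
             (\<lambda>_. True) (x (Suc k))"
  shows "(convex_on UNIV f \<longrightarrow>
           (\<forall>xstar A' L.
              xstar \<in> minimizers f \<longrightarrow>
              bounded A' \<longrightarrow> open A' \<longrightarrow> convex A' \<longrightarrow>
              {y. (norm (y - xstar))\<^sup>2 \<le> (norm (x 0 - xstar))\<^sup>2 + c\<^sup>2} \<subseteq> A' \<longrightarrow>
              0 < L \<longrightarrow> L-lipschitz_on A' f \<longrightarrow>
              f ((1 / (real T + 1)) *\<^sub>R (\<Sum>k=0..T. x k)) - fstar
                \<le> L * ((norm (x 0 - xstar))\<^sup>2 / c + c) / (2 * sqrt (real T + 1))))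
       \<and> (bounded_sublevel_sets f \<longrightarrow>
           (\<forall>lam B' L.
              0 < lam \<longrightarrow> (\<rho> = 0 \<or> lam < 1 / \<rho>) \<longrightarrow>
              bounded B' \<longrightarrow> open B' \<longrightarrow> convex B' \<longrightarrow>
              {y. moreau_envelope lam f y \<le> moreau_envelope lam f (x 0) + c\<^sup>2 / (2 * lam)} \<subseteq> B' \<longrightarrow>
              0 < L \<longrightarrow> L-lipschitz_on B' f \<longrightarrow>
              (MIN k\<in>{0..T}. (norm (gradient (moreau_envelope lam f) (x k)))\<^sup>2)
                \<le> L * (moreau_envelope lam f (x 0) - fstar + c\<^sup>2 / (2 * lam))
                    / (c * (1 - lam * \<rho>) * sqrt (real T + 1))))"
proof -
  note nonneg = assms(5)
  define b where "b = c / sqrt (real T + 1)"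
  have "0 < b" using \<open>0 < c\<close> by (simp add: b_def)
  have b2: "(real T + 1) * b\<^sup>2 = c\<^sup>2"
    by (simp add: b_def power_divide)
  have bT: "b * (real T + 1) = c * sqrt (real T + 1)"
    by (simp add: b_def field_simps)
  have f_ge: "fstar \<le> f y" for y
    unfolding assms(4) using nonneg by (intro cINF_lower bdd_belowI2[where m = 0]) auto
  have \<alpha>: "\<alpha> k = b / norm (g k)" if "k \<le> T" "g k \<noteq> 0" for k
    using assms(8,10) that by (simp add: b_def)
  have convex_case: "f ((1 / (real T + 1)) *\<^sub>R (\<Sum>k=0..T. x k)) - fstar
      \<le> L * ((norm (x 0 - xstar))\<^sup>2 / c + c) / (2 * sqrt (real T + 1))"
    if conv: "convex_on UNIV f" and xs: "xstar \<in> minimizers f" and A: "open A"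
      "{y. (norm (y - xstar))\<^sup>2 \<le> (norm (x 0 - xstar))\<^sup>2 + c\<^sup>2} \<subseteq> A"
      and L: "0 < L" "L-lipschitz_on A f"
    for xstar A L
  proof -
    have "\<And>y. f xstar \<le> f y"
      using xs by (simp add: minimizers_def is_arg_min_linorder)
    then have fx: "f xstar = fstar"
      unfolding assms(4) by (intro cInf_eq_minimum[symmetric]) auto
    define a where "a = (\<lambda>k. (norm (xstar - x k))\<^sup>2)"
    \<comment> \<open>By \<open>b2\<close> the right-hand side is the squared radius of the ball
      contained in \<open>A\<close>, so the invariant of \<open>sum_decrease_le\<close> keeps the
      iterates where \<open>f\<close> is \<open>L\<close>-Lipschitz.\<close>
    have "a (Suc T) + 2 * b / L * (\<Sum>k=0..T. f (x k) - fstar) \<le> a 0 + (real T + 1) * b\<^sup>2"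
    proof (rule sum_decrease_le)
      fix k assume k: "k \<le> T" "a k \<le> a 0 + (real T + 1) * b\<^sup>2"
      then have "x k \<in> A"
        using A(2) by (auto simp: b2 a_def norm_minus_commute)
      then have "norm (g k) \<le> L"
        by (rule norm_subgradient_le_lipschitz[OF assms(7)[OF k(1)] L(2) A(1)])
      moreover have "f (x k) + g k \<bullet> (xstar - x k) \<le> fstar"
        using assms(7)[OF k(1)] subdifferential_convex[OF conv \<open>0 \<le> \<rho>\<close>]
        by (auto simp: convex_subdifferential_def simp flip: fx)
      then have "max (f (x k) + g k \<bullet> (xstar - x k)) 0 + (f (x k) - fstar) \<le> f (x k)"
        using nonneg[of xstar] fx by simp
      ultimately show "a (Suc k) \<le> a k - 2 * b / L * (f (x k) - fstar) + b\<^sup>2"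
        unfolding a_def using assms(9,11) \<alpha> k(1) \<open>0 < b\<close> nonneg f_ge
        by (intro truncated_step_decrease[of "\<alpha> k" "g k" b L "f (x k)"]) auto
    qed (use f_ge \<open>0 < b\<close> L in auto)
    moreover have "0 \<le> a (Suc T)" "a 0 = (norm (x 0 - xstar))\<^sup>2"
      by (simp_all add: a_def norm_minus_commute)
    ultimately have "2 * b / L * (\<Sum>k=0..T. f (x k) - fstar) \<le> (norm (x 0 - xstar))\<^sup>2 + c\<^sup>2"
      unfolding b2 by linarith
    then have total: "(\<Sum>k=0..T. f (x k) - fstar) \<le> L * ((norm (x 0 - xstar))\<^sup>2 + c\<^sup>2) / (2 * b)"
      using L \<open>0 < b\<close> by (simp add: field_simps)
    have "f (\<Sum>k\<in>{0..T}. (1 / (real T + 1)) *\<^sub>R x k) \<le> (\<Sum>k\<in>{0..T}. (1 / (real T + 1)) * f (x k))"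
      by (intro convex_on_sum[OF _ _ conv]) auto
    then have "f ((1 / (real T + 1)) *\<^sub>R (\<Sum>k=0..T. x k)) \<le> (1 / (real T + 1)) * (\<Sum>k=0..T. f (x k))"
      by (simp add: scaleR_sum_right sum_distrib_left)
    then have "f ((1 / (real T + 1)) *\<^sub>R (\<Sum>k=0..T. x k)) - fstar
        \<le> (1 / (real T + 1)) * (\<Sum>k=0..T. f (x k) - fstar)"
      by (simp add: sum_subtractf field_simps)
    also have "\<dots> \<le> (1 / (real T + 1)) * (L * ((norm (x 0 - xstar))\<^sup>2 + c\<^sup>2) / (2 * b))"
      using total by (intro mult_left_mono) auto
    also have "\<dots> = L * ((norm (x 0 - xstar))\<^sup>2 + c\<^sup>2) / (2 * (b * (real T + 1)))"
      by simp
    also have "\<dots> = L * ((norm (x 0 - xstar))\<^sup>2 / c + c) / (2 * sqrt (real T + 1))"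
      unfolding bT using \<open>0 < c\<close> by (simp add: field_simps power2_eq_square)
    finally show ?thesis .
  qed
  have weakly_convex_case: "(MIN k\<in>{0..T}. (norm (gradient (moreau_envelope lam f) (x k)))\<^sup>2)
      \<le> L * (moreau_envelope lam f (x 0) - fstar + c\<^sup>2 / (2 * lam))
          / (c * (1 - lam * \<rho>) * sqrt (real T + 1))"
    if lam: "0 < lam" "\<rho> = 0 \<or> lam < 1 / \<rho>" and B: "open B"
      "{y. moreau_envelope lam f y \<le> moreau_envelope lam f (x 0) + c\<^sup>2 / (2 * lam)} \<subseteq> B"
      and L: "0 < L" "L-lipschitz_on B f"
    for lam B L
  proof -
    let ?e = "moreau_envelope lam f"
    let ?G = "\<lambda>k. (norm (gradient ?e (x k)))\<^sup>2"
    \<comment> \<open>The case \<rho> = 0 is separate because 1 / 0 is 0 here instead of infinity;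
      both cases give this form.\<close>
    have rl: "\<rho> < 1 / lam"
      using lam \<open>0 \<le> \<rho>\<close> by (cases "\<rho> = 0") (auto simp: field_simps)
    then have pos: "0 < 1 - lam * \<rho>" using lam by (simp add: field_simps)
    define \<gamma> where "\<gamma> = b\<^sup>2 / (2 * lam)"
    have \<gamma>: "(real T + 1) * \<gamma> = c\<^sup>2 / (2 * lam)"
      unfolding \<gamma>_def b2[symmetric] by simp
    \<comment> \<open>The envelope itself is the decreasing quantity; its factor 1 / (2 lam) scales
      the error per step to \<gamma>, and the resulting bound is the level that defines the sublevel
      set inside \<open>B\<close>.\<close>
    have "?e (x (Suc T)) + b * (1 - lam * \<rho>) / L * (\<Sum>k=0..T. ?G k) \<le> ?e (x 0) + (real T + 1) * \<gamma>"
    proof (rule sum_decrease_le[where a = "\<lambda>k. ?e (x k)"])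
      fix k assume k: "k \<le> T" "?e (x k) \<le> ?e (x 0) + (real T + 1) * \<gamma>"
      then have "x k \<in> B" using B(2) by (auto simp: \<gamma>)
      then have gL: "norm (g k) \<le> L"
        by (rule norm_subgradient_le_lipschitz[OF assms(7)[OF k(1)] L(2) B(1)])
      obtain p where p: "?e (x k) = f p + 1 / (2 * lam) * (norm (p - x k))\<^sup>2"
        "\<And>y. ?e (x k) + (1 / lam - \<rho>) / 2 * (norm (y - p))\<^sup>2
           \<le> f y + 1 / (2 * lam) * (norm (y - x k))\<^sup>2"
        "gradient ?e (x k) = (1 / lam) *\<^sub>R (x k - p)"
        using moreau_envelope_proximal_point[where f = f, OF assms(2) nonneg lam(1) rl, of "x k"] by blast
      define N where "N = (norm (p - x k))\<^sup>2"
      have G: "lam * (1 - lam * \<rho>) * ?G k = (1 / lam - \<rho>) * N"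
        unfolding p(3) N_def norm_scaleR power_mult_distrib norm_minus_commute[of p] using lam
        by (simp add: field_simps power2_eq_square)
      have half: "(1 / lam - \<rho>) / 2 * N = ((1 / lam - \<rho>) * N) / 2"
        "1 / (2 * lam) * N = ((1 / lam - \<rho>) * N) / 2 + \<rho> / 2 * N"
        by (simp_all add: left_diff_distrib diff_divide_distrib)
      \<comment> \<open>This is the growth around \<open>p\<close> evaluated at \<open>x k\<close>.
        The model at \<open>p\<close> exceeds \<open>f p\<close> by at most \<rho> / 2 * N, so the
        net model decrease is (1 / lam - \<rho>) * N.\<close>
      have "f p + 1 / (2 * lam) * N + (1 / lam - \<rho>) / 2 * N \<le> f (x k)"
        using p(2)[of "x k"] unfolding p(1) N_def by (simp add: norm_minus_commute)
      moreover have "f (x k) + g k \<bullet> (p - x k) \<le> f p + \<rho> / 2 * N"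
        unfolding N_def by (rule subdifferentialD[OF assms(7)[OF k(1)]])
      then have "max (f (x k) + g k \<bullet> (p - x k)) 0 \<le> f p + \<rho> / 2 * N"
        using nonneg[of p] \<open>0 \<le> \<rho>\<close> by (simp add: N_def)
      ultimately have D: "max (f (x k) + g k \<bullet> (p - x k)) 0 + (1 / lam - \<rho>) * N \<le> f (x k)"
        using half by linarith
      have "(norm (p - x (Suc k)))\<^sup>2
          \<le> (norm (p - x k))\<^sup>2 - 2 * b / L * ((1 / lam - \<rho>) * N) + b\<^sup>2"
        using assms(9,11) \<alpha> k(1) \<open>0 < b\<close> nonneg gL D rl
        by (intro truncated_step_decrease[of "\<alpha> k" "g k" b L "f (x k)"]) (auto simp: N_def)
      then have step: "(norm (p - x (Suc k)))\<^sup>2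
          \<le> N - 2 * b / L * (lam * (1 - lam * \<rho>) * ?G k) + b\<^sup>2"
        by (simp add: G N_def)
      \<comment> \<open>The proximal point of the old iterate serves as a competitor at the new
        one.\<close>
      have "?e (x (Suc k)) \<le> f p + 1 / (2 * lam) * (norm (p - x (Suc k)))\<^sup>2"
        by (rule moreau_envelope_le[where f = f, OF nonneg lam(1)])
      also have "\<dots> \<le> f p + 1 / (2 * lam) * (N - 2 * b / L * (lam * (1 - lam * \<rho>) * ?G k) + b\<^sup>2)"
        using lam by (intro add_left_mono mult_left_mono step) simp
      also have "\<dots> = ?e (x k) - b * (1 - lam * \<rho>) / L * ?G k + \<gamma>"
        unfolding p(1) N_def[symmetric] \<gamma>_def using lam by (simp add: field_simps)
      finally show "?e (x (Suc k)) \<le> ?e (x k) - b * (1 - lam * \<rho>) / L * ?G k + \<gamma>" .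
    qed (use \<open>0 < b\<close> L pos lam in \<open>auto simp: \<gamma>_def\<close>)
    moreover have "fstar \<le> ?e (x (Suc T))"
      unfolding moreau_envelope_def
      using f_ge lam by (intro cINF_greatest) (auto intro: add_increasing2)
    ultimately have "b * (1 - lam * \<rho>) / L * (\<Sum>k=0..T. ?G k) \<le> ?e (x 0) - fstar + c\<^sup>2 / (2 * lam)"
      by (simp add: \<gamma>)
    moreover
    \<comment> \<open>The sum has T + 1 terms; together with \<open>bT\<close> this produces the
      factor c sqrt(T + 1) of the rate.\<close>
    have "(\<Sum>k=0..T. (MIN k\<in>{0..T}. ?G k)) \<le> (\<Sum>k=0..T. ?G k)"
      by (intro sum_mono Min_le) auto
    then have "(real T + 1) * (MIN k\<in>{0..T}. ?G k) \<le> (\<Sum>k=0..T. ?G k)"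
      by (simp add: add.commute)
    then have "b * (1 - lam * \<rho>) / L * ((real T + 1) * (MIN k\<in>{0..T}. ?G k))
        \<le> b * (1 - lam * \<rho>) / L * (\<Sum>k=0..T. ?G k)"
      using \<open>0 < b\<close> L pos by (intro mult_left_mono) auto
    ultimately have "b * (1 - lam * \<rho>) / L * ((real T + 1) * (MIN k\<in>{0..T}. ?G k))
        \<le> ?e (x 0) - fstar + c\<^sup>2 / (2 * lam)"
      by linarith
    then have "(b * (real T + 1)) * (1 - lam * \<rho>) / L * (MIN k\<in>{0..T}. ?G k)
        \<le> ?e (x 0) - fstar + c\<^sup>2 / (2 * lam)"
      by (simp only: mult_ac times_divide_eq_left times_divide_eq_right)
    moreover define M where "M = (MIN k\<in>{0..T}. ?G k)"
    moreover define R where "R = ?e (x 0) - fstar + c\<^sup>2 / (2 * lam)"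
    ultimately have "c * (1 - lam * \<rho>) * sqrt (real T + 1) * M \<le> L * R"
      unfolding bT using L by (simp add: pos_divide_le_eq mult_ac)
    moreover have "0 < c * (1 - lam * \<rho>) * sqrt (real T + 1)"
      using \<open>0 < c\<close> pos by simp
    ultimately have "M \<le> L * R / (c * (1 - lam * \<rho>) * sqrt (real T + 1))"
      by (simp only: pos_le_divide_eq mult.commute)
    then show ?thesis unfolding M_def R_def .
  qed
  show ?thesis using convex_case weakly_convex_case by blast
qed

end
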